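(* Let $L\in\mathbb{N}$, $L\ge1$, and let $G_1,\dots,G_L\in\mathbb{R}^{d\times d}$ be symmetric and positive definite. For $\delta\ge0$ define on $\mathbb{R}^d$ $$\gamma_l^\delta(p):=\sqrt{p^TG_lp+\delta},\qquad \gamma_\delta(p):=\sum_{l=1}^L\gamma_l^\delta(p),\qquad A_\delta(p):=\tfrac12|\gamma_\delta(p)|^2,\qquad A:=A_0 .$$ Then the mappings $A_\delta:\mathbb{R}^d\to\mathbb{R}$, $\delta\ge0$, have the following properties: a) $A_\delta$ fulfill the growth condition $c|p|^2\le A_\delta(p)\le C_\delta+C|p|^2$ for all $p\in\mathbb{R}^d$ with positive constants $c,C,C_\delta$, where only $C_\delta$ may depend on $\delta$. b) $A_\delta'$ are Lipschitz continuous and strongly monotone on $\mathbb{R}^d$ with constants independent of $\delta$, and $A_\delta'(0)=0$. c) $A_\delta''$ induce uniformly equivalent norms on $\mathbb{R}^d$ for $\delta>0$, i.e. there exist positive constants $c_0,C$ such that $$c_0\|q\|^2\le q^TA_\delta''(p)q\le C\|q\|^2\qquad\forall p,q\in\mathbb{R}^d,\ \delta>0,$$ and $A_\delta''(0)=L\sum_{l=1}^LG_l$ for $\delta>0$. Furthermore, if $\delta=0$ the same inequalities hold true for all $p\ne0$. d) $\delta\mapsto A_\delta'(p)$ is Hölder continuous on $[0,\infty)$ with exponent $1/2$ and with a constant independent of $p$. Especially, $$|A_\delta'(p)-A'(p)|\le C\sqrt\delta\qquad\forall p\in\mathbb{R}^d,\ \delta>0 .$$ In particular: for $\delta>0$,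 $A_\delta\in C^2(\mathbb{R}^d)$ with bounded $A_\delta''$, $A_\delta'$ is strongly monotone and $|A_\delta'(p)|\le C|p|$ for all $p$; moreover $A\in C^1(\mathbb{R}^d)$ with $A'$ strongly monotone and $|A'(p)|\le C|p|$ for all $p$; and the family satisfies: $A_\delta'$ is strongly monotone with a constant independent of $\delta$ and $|A_\delta'(p)-A'(p)|\le\eta(\delta)$ for all $p\in\mathbb{R}^d$, with some $\eta$ satisfying $\lim_{\delta\to0}\eta(\delta)=0$.
   Context: Primes denote derivatives with respect to $p$ ($A_\delta'$ the gradient, $A_\delta''$ the Hessian). A map $F:\mathbb{R}^d\to\mathbb{R}^d$ is strongly monotone if there is $C_F>0$ with $(F(p)-F(q))\cdot(p-q)\ge C_F|p-q|^2$ for all $p,q\in\mathbb{R}^d$. *)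

theory Defs
  imports "HOL-Analysis.Analysis"
begin

definition pos_def_matrix :: "real^'n^'n \<Rightarrow> bool" where
  "pos_def_matrix M \<longleftrightarrow> (\<forall>x. x \<noteq> 0 \<longrightarrow> 0 < x \<bullet> (M *v x))"

definition gamma_comp :: "(nat \<Rightarrow> real^'n^'n) \<Rightarrow> real \<Rightarrow> nat \<Rightarrow> real^'n \<Rightarrow> real" where
  "gamma_comp G \<delta> l p = sqrt (p \<bullet> (G l *v p) + \<delta>)"

definition gamma_sum :: "nat \<Rightarrow> (nat \<Rightarrow> real^'n^'n) \<Rightarrow> real \<Rightarrow> real^'n \<Rightarrow> real" where
  "gamma_sum L G \<delta> p = (\<Sum>l=1..L. gamma_comp G \<delta> l p)"

definition aniso :: "nat \<Rightarrow> (nat \<Rightarrow> real^'n^'n) \<Rightarrow> real \<Rightarrow> real^'n \<Rightarrow> real" where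
  "aniso L G \<delta> p = 1 / 2 * \<bar>gamma_sum L G \<delta> p\<bar>\<^sup>2"

text \<open>
  The gradient and the Hessian are total functions, with an unspecified value at points where the
  derivative in question does not exist. Statements about them therefore come with separate
  differentiability claims.
\<close>

definition gradient :: "(real^'n \<Rightarrow> real) \<Rightarrow> real^'n \<Rightarrow> real^'n" where
  "gradient f p = (THE D. GDERIV f p :> D)"

definition hessian :: "(real^'n \<Rightarrow> real) \<Rightarrow> real^'n \<Rightarrow> real^'n^'n" where
  "hessian f p = jacobian (gradient f) (at p)"

lemma gradient_eqI:
  assumes "GDERIV f p :> D"
  shows "gradient f p = D"
  unfolding gradient_def
proof (rule the_equality)
  show "GDERIV f p :> D" by (fact assms)
next
  fix E
  assume "GDERIV f p :> E"
  then have "(\<lambda>h. h \<bullet> E) = (\<lambda>h. h \<bullet> D)"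
    using assms unfolding gderiv_def by (rule has_derivative_unique)
  then have "h \<bullet> E = h \<bullet> D" for h by (rule fun_cong)
  then show "E = D" using vector_eq_ldot[of E D] by blast
qed

lemma GDERIV_gradient:
  assumes "f differentiable (at p)"
  shows "GDERIV f p :> gradient f p"
proof -
  obtain f' where f': "(f has_derivative f') (at p)"
    using assms unfolding differentiable_def by blast
  then have "linear f'" by (rule has_derivative_linear)
  then have "h \<bullet> adjoint f' 1 = f' h" for h
    using adjoint_works[of f' h 1] by simp
  then have "f' = (\<lambda>h. h \<bullet> adjoint f' 1)" by presburger
  then have "GDERIV f p :> adjoint f' 1"
    using f' unfolding gderiv_def by simp
  then show ?thesis
    using gradient_eqI[of f p "adjoint f' 1"] by simp
qed

definition C1_function :: "(real^'n \<Rightarrow> real) \<Rightarrow> bool" where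
  "C1_function f \<longleftrightarrow> (\<forall>p. f differentiable (at p)) \<and> continuous_on UNIV (gradient f)"

definition C2_function :: "(real^'n \<Rightarrow> real) \<Rightarrow> bool" where
  "C2_function f \<longleftrightarrow> C1_function f \<and> (\<forall>p. gradient f differentiable (at p))
     \<and> continuous_on UNIV (hessian f)"

definition strongly_monotone_const :: "real \<Rightarrow> (real^'n \<Rightarrow> real^'n) \<Rightarrow> bool" where
  "strongly_monotone_const c F \<longleftrightarrow>
     0 < c \<and> (\<forall>p q. (F p - F q) \<bullet> (p - q) \<ge> c * (norm (p - q))\<^sup>2)"

definition strongly_monotone :: "(real^'n \<Rightarrow> real^'n) \<Rightarrow> bool" where
  "strongly_monotone F \<longleftrightarrow> (\<exists>c. strongly_monotone_const c F)"

definition holder_on ::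
    "real \<Rightarrow> real \<Rightarrow> 'a::metric_space set \<Rightarrow> ('a \<Rightarrow> 'b::metric_space) \<Rightarrow> bool" where
  "holder_on C \<alpha> S f \<longleftrightarrow> (\<forall>x\<in>S. \<forall>y\<in>S. dist (f x) (f y) \<le> C * dist x y powr \<alpha>)"

end

(*
  With gamma = sum_l g_l the gradient of A_delta is sum_l (gamma / g_l) G_l p, and its second
  derivative has the quadratic form
    (sum_l a_l)^2 + sum_l (gamma / g_l) (q . G_l q - a_l^2),   a_l = (G_l p . q) / g_l.
  The products g_k g_l need not be convex, so coercivity is not visible pair by pair. It comes from
  splitting q into a multiple of p, which the first term controls, and the g_l-weighted average of
  the parts q - (a_l / g_l) p, each controlled by the second term. All bounds are uniform in delta;
  strong monotonicity and the Lipschitz bound for delta > 0 follow from the mean value theorem and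
  pass to delta = 0 by the Hoelder estimate in delta.
*)
theory Submission
  imports Defs
begin

text \<open>The form is continuous on the compact unit sphere, so it attains its minimum there,
  which is positive; homogeneity of degree two carries this minimum over to all vectors as the
  constant.\<close>

lemma pos_def_matrix_lower_bound:
  fixes M :: "real^'n^'n"
  assumes "pos_def_matrix M"
  obtains m where "m > 0" "\<And>p. m * (norm p)\<^sup>2 \<le> p \<bullet> (M *v p)"
proof -
  have cont: "continuous_on (sphere 0 1) (\<lambda>x::real^'n. x \<bullet> (M *v x))"
    by (intro continuous_intros matrix_vector_mult_linear_continuous_on)
  have ne: "sphere (0::real^'n) 1 \<noteq> {}"
    by simp
  obtain x where x: "x \<in> sphere 0 1" "\<forall>y\<in>sphere 0 1. x \<bullet> (M *v x) \<le> y \<bullet> (M *v y)"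
    using continuous_attains_inf[OF compact_sphere ne cont] by blast
  show thesis
  proof
    show "0 < x \<bullet> (M *v x)"
      using x(1) assms unfolding pos_def_matrix_def by (metis dist_0_norm mem_sphere norm_zero zero_neq_one)
    fix p :: "real^'n"
    show "x \<bullet> (M *v x) * (norm p)\<^sup>2 \<le> p \<bullet> (M *v p)"
    proof (cases "p = 0")
      case False
      define y where "y = (1 / norm p) *\<^sub>R p"
      have "p = norm p *\<^sub>R y" "y \<in> sphere 0 1"
        using False by (auto simp: y_def)
      then have "p \<bullet> (M *v p) = (norm p)\<^sup>2 * (y \<bullet> (M *v y))"
        by (metis (no_types, lifting) inner_scaleR_left inner_scaleR_right matrix_vector_mult_scaleR
            mult.assoc power2_eq_square)
      with x(2) \<open>y \<in> sphere 0 1\<close> show ?thesis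
        by (metis mult.commute mult_left_mono zero_le_power2)
    qed simp
  qed
qed

text \<open>Positive definiteness enters only through one pair \<open>m\<close>, \<open>M\<close>
  shared by all the matrices. Every later constant is built from \<open>L\<close>, \<open>m\<close>,
  \<open>M\<close>, which makes its independence of \<open>\<delta>\<close> and \<open>p\<close>
  visible.\<close>

locale aniso_bounds =
  fixes L :: nat and G :: "nat \<Rightarrow> real^'n^'n" and m M :: real
  assumes L_ge_1: "L \<ge> 1"
    and sym: "l \<in> {1..L} \<Longrightarrow> (G l *v p) \<bullet> q = p \<bullet> (G l *v q)"
    and m_pos: "m > 0"
    and lower: "l \<in> {1..L} \<Longrightarrow> m * (norm p)\<^sup>2 \<le> p \<bullet> (G l *v p)"
    and upper: "l \<in> {1..L} \<Longrightarrow> norm (G l *v p) \<le> M * norm p"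
begin

section \<open>Elementary bounds for the summands, their sum and the energy\<close>

abbreviation g :: "real \<Rightarrow> nat \<Rightarrow> real^'n \<Rightarrow> real" where
  "g \<equiv> gamma_comp G"

abbreviation \<gamma> :: "real \<Rightarrow> real^'n \<Rightarrow> real" where
  "\<gamma> \<equiv> gamma_sum L G"

lemma quad_upper: "l \<in> {1..L} \<Longrightarrow> p \<bullet> (G l *v p) \<le> M * (norm p)\<^sup>2"
proof -
  assume l: "l \<in> {1..L}"
  have "p \<bullet> (G l *v p) \<le> norm p * norm (G l *v p)"
    by (rule norm_cauchy_schwarz)
  also have "\<dots> \<le> norm p * (M * norm p)"
    using upper[OF l] by (intro mult_left_mono) auto
  finally show ?thesis
    by (simp add: power2_eq_square algebra_simps)
qed

lemma quad_nonneg: "l \<in> {1..L} \<Longrightarrow> 0 \<le> p \<bullet> (G l *v p)"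
  using lower[of l p] m_pos by (meson mult_nonneg_nonneg order.trans less_imp_le zero_le_power2)

lemma m_le_M: "m \<le> M"
proof -
  \<comment> \<open>Any unit vector would do; the index type is nonempty, so a coordinate vector
    exists.\<close>
  have "m * (norm (axis undefined 1 :: real^'n))\<^sup>2 \<le> M * (norm (axis undefined 1 :: real^'n))\<^sup>2"
    using lower[of 1] quad_upper[of 1] L_ge_1 by (meson atLeastAtMost_iff order.refl order.trans)
  then show ?thesis
    by simp
qed

lemma M_pos: "M > 0"
  using m_le_M m_pos by linarith

lemma g_nonneg: "l \<in> {1..L} \<Longrightarrow> \<delta> \<ge> 0 \<Longrightarrow> 0 \<le> g \<delta> l p"
  using quad_nonneg[of l p] by (simp add: gamma_comp_def)

lemma g_sq: "l \<in> {1..L} \<Longrightarrow> \<delta> \<ge> 0 \<Longrightarrow> (g \<delta> l p)\<^sup>2 = p \<bullet> (G l *v p) + \<delta>"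
  using quad_nonneg[of l p] by (simp add: gamma_comp_def)

lemma norm_le_g: "l \<in> {1..L} \<Longrightarrow> \<delta> \<ge> 0 \<Longrightarrow> sqrt m * norm p \<le> g \<delta> l p"
proof -
  assume l: "l \<in> {1..L}" and d: "\<delta> \<ge> 0"
  have "(sqrt m * norm p)\<^sup>2 \<le> (g \<delta> l p)\<^sup>2"
    using lower[OF l, of p] m_pos d unfolding g_sq[OF l d] by (simp add: power_mult_distrib)
  then show ?thesis
    using g_nonneg[OF l d] by (rule power2_le_imp_le)
qed

lemma g_pos:
  assumes "l \<in> {1..L}" "\<delta> \<ge> 0" "\<delta> > 0 \<or> p \<noteq> 0"
  shows "0 < g \<delta> l p"
proof -
  have "0 < p \<bullet> (G l *v p) + \<delta>"
  proof (cases "p = 0")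
    case False
    then have "0 < m * (norm p)\<^sup>2"
      using m_pos by simp
    then show ?thesis
      using lower[OF assms(1), of p] assms(2) by linarith
  qed (use assms in simp)
  then show ?thesis
    by (simp add: gamma_comp_def)
qed

text \<open>This makes the quotients \<open>G l *v p / g \<delta> l p\<close>, which occur in all
  derivatives, bounded uniformly in \<open>p\<close> and \<open>\<delta>\<close>, even near the
  origin.\<close>

lemma norm_G_le_g: "l \<in> {1..L} \<Longrightarrow> \<delta> \<ge> 0 \<Longrightarrow> norm (G l *v p) \<le> M / sqrt m * g \<delta> l p"
proof -
  assume l: "l \<in> {1..L}" and d: "\<delta> \<ge> 0"
  have "norm (G l *v p) \<le> M / sqrt m * (sqrt m * norm p)"
    using upper[OF l, of p] m_pos by simp
  also have "\<dots> \<le> M / sqrt m * g \<delta> l p"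
    using norm_le_g[OF l d, of p] M_pos m_pos by (intro mult_left_mono) auto
  finally show ?thesis .
qed

text \<open>Under the root, the quadratic parts compare with factor \<open>M / m\<close>. Since this
  factor is at least 1, the common summand \<open>\<delta>\<close> obeys the same comparison, so no
  dependence on \<open>\<delta>\<close> appears.\<close>

lemma g_comparable:
  assumes k: "k \<in> {1..L}" and l: "l \<in> {1..L}" and d: "\<delta> \<ge> 0"
  shows "g \<delta> k p \<le> sqrt (M / m) * g \<delta> l p"
proof -
  have "1 * \<delta> \<le> M / m * \<delta>"
    using m_pos m_le_M d by (intro mult_right_mono) auto
  then have "p \<bullet> (G k *v p) + \<delta> \<le> M / m * (m * (norm p)\<^sup>2) + M / m * \<delta>"
    using quad_upper[OF k, of p] m_pos by (intro add_mono) auto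
  also have "\<dots> \<le> M / m * (p \<bullet> (G l *v p) + \<delta>)"
    using lower[OF l, of p] m_pos M_pos unfolding distrib_left
    by (intro add_mono mult_left_mono) auto
  finally show ?thesis
    unfolding gamma_comp_def real_sqrt_mult[symmetric] by (rule real_sqrt_le_mono)
qed

lemma gamma_ge_g: "l \<in> {1..L} \<Longrightarrow> \<delta> \<ge> 0 \<Longrightarrow> g \<delta> l p \<le> \<gamma> \<delta> p"
  unfolding gamma_sum_def by (rule member_le_sum) (auto intro: g_nonneg)

lemma gamma_nonneg: "\<delta> \<ge> 0 \<Longrightarrow> 0 \<le> \<gamma> \<delta> p"
  unfolding gamma_sum_def by (auto intro!: sum_nonneg g_nonneg)

text \<open>Bounds the weights \<open>\<gamma> \<delta> p / g \<delta> l p\<close> with which the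
  matrices enter the gradient.\<close>

lemma gamma_comparable:
  assumes l: "l \<in> {1..L}" and d: "\<delta> \<ge> 0"
  shows "\<gamma> \<delta> p \<le> L * sqrt (M / m) * g \<delta> l p"
proof -
  have "\<gamma> \<delta> p \<le> (\<Sum>k=1..L. sqrt (M / m) * g \<delta> l p)"
    unfolding gamma_sum_def using g_comparable l d by (intro sum_mono) auto
  then show ?thesis
    by simp
qed

text \<open>A single summand already suffices, and \<open>L \<ge> 1\<close> provides one.\<close>

lemma norm_le_gamma: "\<delta> \<ge> 0 \<Longrightarrow> sqrt m * norm p \<le> \<gamma> \<delta> p"
  using norm_le_g[of 1 \<delta> p] gamma_ge_g[of 1 \<delta> p] L_ge_1 by auto

lemma gamma_pos: "\<delta> \<ge> 0 \<Longrightarrow> \<delta> > 0 \<or> p \<noteq> 0 \<Longrightarrow> 0 < \<gamma> \<delta> p"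
  using g_pos[of 1 \<delta> p] gamma_ge_g[of 1 \<delta> p] L_ge_1 by auto

lemma gamma_upper_sq:
  assumes "\<delta> \<ge> 0"
  shows "(\<gamma> \<delta> p)\<^sup>2 \<le> (real L)\<^sup>2 * (M * (norm p)\<^sup>2 + \<delta>)"
proof -
  have "\<gamma> \<delta> p \<le> (\<Sum>k=1..L. sqrt (M * (norm p)\<^sup>2 + \<delta>))"
    unfolding gamma_sum_def gamma_comp_def using quad_upper by (intro sum_mono) auto
  then have "\<gamma> \<delta> p \<le> L * sqrt (M * (norm p)\<^sup>2 + \<delta>)"
    by simp
  then have "(\<gamma> \<delta> p)\<^sup>2 \<le> (L * sqrt (M * (norm p)\<^sup>2 + \<delta>))\<^sup>2"
    using gamma_nonneg[OF assms] by (intro power_mono)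
  then show ?thesis
    using M_pos assms by (simp add: power_mult_distrib)
qed

lemma aniso_eq: "aniso L G \<delta> p = 1/2 * (\<gamma> \<delta> p)\<^sup>2"
  by (simp add: aniso_def)

lemma aniso_lower: "\<delta> \<ge> 0 \<Longrightarrow> m / 2 * (norm p)\<^sup>2 \<le> aniso L G \<delta> p"
proof -
  assume "\<delta> \<ge> 0"
  then have "(sqrt m * norm p)\<^sup>2 \<le> (\<gamma> \<delta> p)\<^sup>2"
    using norm_le_gamma m_pos by (intro power_mono) auto
  then show ?thesis
    using m_pos by (simp add: aniso_eq power_mult_distrib)
qed

lemma aniso_upper: "\<delta> \<ge> 0 \<Longrightarrow> aniso L G \<delta> p \<le> (real L)\<^sup>2 * \<delta> / 2 + (real L)\<^sup>2 * M / 2 * (norm p)\<^sup>2"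
  using gamma_upper_sq[of \<delta> p] by (simp add: aniso_eq algebra_simps)

section \<open>First derivative\<close>

lemma has_derivative_g:
  assumes "l \<in> {1..L}" "\<delta> \<ge> 0" "\<delta> > 0 \<or> p \<noteq> 0"
  shows "(g \<delta> l has_derivative (\<lambda>h. (G l *v p) \<bullet> h / g \<delta> l p)) (at p)"
proof -
  have pos: "0 < p \<bullet> (G l *v p) + \<delta>"
    using g_pos[OF assms] by (simp add: gamma_comp_def)
  have lin: "((\<lambda>p. G l *v p) has_derivative (\<lambda>h. G l *v h)) (at p)"
    by (rule linear_imp_has_derivative) simp
  \<comment> \<open>Symmetry merges the two terms of the product rule; the resulting factor 2
    cancels against the one from the square root.\<close>
  have "((\<lambda>p. p \<bullet> (G l *v p) + \<delta>) has_derivative (\<lambda>h. 2 * ((G l *v p) \<bullet> h))) (at p)"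
    by (rule derivative_eq_intros lin refl)+
      (simp add: fun_eq_iff sym[OF assms(1), of p, symmetric] inner_commute[of _ "G l *v p"])
  from has_derivative_real_sqrt[OF pos this] show ?thesis
    unfolding gamma_comp_def[abs_def] by (simp add: inverse_eq_divide)
qed

lemma has_derivative_gamma:
  assumes "\<delta> \<ge> 0" "\<delta> > 0 \<or> p \<noteq> 0"
  shows "(\<gamma> \<delta> has_derivative (\<lambda>h. \<Sum>l=1..L. (G l *v p) \<bullet> h / g \<delta> l p)) (at p)"
  unfolding gamma_sum_def[abs_def] using assms by (intro has_derivative_sum has_derivative_g)

text \<open>At \<open>\<delta> = 0\<close>, \<open>p = 0\<close> the quotient is \<open>0 / 0 = 0\<close>, so the formula still gives the gradient.\<close>

definition grad :: "real \<Rightarrow> real^'n \<Rightarrow> real^'n" where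
  "grad \<delta> p = (\<Sum>l=1..L. (\<gamma> \<delta> p / g \<delta> l p) *\<^sub>R (G l *v p))"

lemma grad_0 [simp]: "grad \<delta> 0 = 0"
  by (simp add: grad_def)

text \<open>The chain rule covers every case except \<open>\<delta> = 0\<close>,
  \<open>p = 0\<close>, where the roots are not differentiable. There the energy is bounded by a
  multiple of the squared norm, so its derivative vanishes, in agreement with
  \<open>grad_0\<close>.\<close>

lemma GDERIV_aniso:
  assumes "\<delta> \<ge> 0"
  shows "GDERIV (aniso L G \<delta>) p :> grad \<delta> p"
proof (cases "\<delta> > 0 \<or> p \<noteq> 0")
  case True
  have "((\<lambda>p. 1/2 * (\<gamma> \<delta> p)\<^sup>2) has_derivative
      (\<lambda>h. \<gamma> \<delta> p * (\<Sum>l=1..L. (G l *v p) \<bullet> h / g \<delta> l p))) (at p)"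
    by (rule derivative_eq_intros has_derivative_gamma assms True refl)+ auto
  then show ?thesis
    unfolding gderiv_def aniso_eq[abs_def] grad_def
    by (simp add: inner_sum_right sum_distrib_left inner_commute)
next
  case False
  then have "\<delta> = 0" "p = 0"
    using assms by auto
  define C where "C = (real L)\<^sup>2 * M / 2"
  have "C \<ge> 0"
    using M_pos by (simp add: C_def)
  have bd: "norm (aniso L G 0 y) \<le> C * (norm y)\<^sup>2" for y
    using aniso_upper[of 0 y] by (simp add: C_def aniso_eq)
  have "((\<lambda>y. C * norm y) \<longlongrightarrow> 0) (at (0::real^'n))"
    by (auto intro!: tendsto_eq_intros)
  moreover have "\<forall>\<^sub>F y in at 0. norm (aniso L G 0 y / norm y) \<le> C * norm y"
    using bd by (intro eventually_at_filter[THEN iffD2] always_eventually)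
      (auto simp: field_simps power2_eq_square)
  ultimately have "((\<lambda>y. aniso L G 0 y / norm y) \<longlongrightarrow> 0) (at 0)"
    by (rule Lim_null_comparison[rotated])
  then have "((\<lambda>y. norm (aniso L G 0 y / norm y)) \<longlongrightarrow> 0) (at 0)"
    by (rule tendsto_norm_zero)
  moreover have "aniso L G 0 0 = 0"
    using bd[of 0] by simp
  ultimately have "(aniso L G 0 has_derivative (\<lambda>h. 0)) (at 0)"
    by (simp add: has_derivative_at)
  then show ?thesis
    using \<open>\<delta> = 0\<close> \<open>p = 0\<close> by (simp add: gderiv_def)
qed

lemma gradient_aniso: "\<delta> \<ge> 0 \<Longrightarrow> gradient (aniso L G \<delta>) = grad \<delta>"
  using gradient_eqI[OF GDERIV_aniso] by blast

section \<open>Second derivative and its uniform bounds\<close>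

definition hess :: "real \<Rightarrow> real^'n \<Rightarrow> real^'n \<Rightarrow> real^'n" where
  "hess \<delta> p q = (\<Sum>l=1..L.
     ((\<Sum>k=1..L. (G k *v p) \<bullet> q / g \<delta> k p) / g \<delta> l p) *\<^sub>R (G l *v p)
     + (\<gamma> \<delta> p / g \<delta> l p) *\<^sub>R (G l *v q)
     - (\<gamma> \<delta> p * ((G l *v p) \<bullet> q) / g \<delta> l p ^ 3) *\<^sub>R (G l *v p))"

lemma has_derivative_grad:
  assumes "\<delta> \<ge> 0" "\<delta> > 0 \<or> p \<noteq> 0"
  shows "(grad \<delta> has_derivative hess \<delta> p) (at p)"
proof -
  \<comment> \<open>The three pieces come from differentiating, in turn, the numerator
    \<open>\<gamma>\<close>, the linear factor \<open>G l *v p\<close> and the denominator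
    \<open>g\<close>.\<close>
  have summand: "((\<lambda>p. (\<gamma> \<delta> p / g \<delta> l p) *\<^sub>R (G l *v p)) has_derivative (\<lambda>q.
      ((\<Sum>k=1..L. (G k *v p) \<bullet> q / g \<delta> k p) / g \<delta> l p) *\<^sub>R (G l *v p)
     + (\<gamma> \<delta> p / g \<delta> l p) *\<^sub>R (G l *v q)
     - (\<gamma> \<delta> p * ((G l *v p) \<bullet> q) / g \<delta> l p ^ 3) *\<^sub>R (G l *v p))) (at p)"
    if l: "l \<in> {1..L}" for l
  proof -
    have lin: "((\<lambda>p. G l *v p) has_derivative (\<lambda>h. G l *v h)) (at p)"
      by (rule linear_imp_has_derivative) simp
    have pos: "g \<delta> l p > 0"
      by (rule g_pos[OF l assms])
    have quot: "((\<lambda>p. \<gamma> \<delta> p / g \<delta> l p) has_derivative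
        (\<lambda>q. ((\<Sum>k=1..L. (G k *v p) \<bullet> q / g \<delta> k p) * g \<delta> l p
          - \<gamma> \<delta> p * ((G l *v p) \<bullet> q / g \<delta> l p)) / (g \<delta> l p * g \<delta> l p))) (at p)"
      using pos by (intro has_derivative_divide' has_derivative_gamma has_derivative_g assms l) simp
    show ?thesis
      by (rule has_derivative_eq_rhs[OF has_derivative_scaleR[OF quot lin]])
        (use pos in \<open>auto simp: fun_eq_iff algebra_simps diff_divide_distrib power3_eq_cube\<close>)
  qed
  show ?thesis
    unfolding grad_def[abs_def] hess_def[abs_def] by (rule has_derivative_sum[OF summand])
qed

lemma grad_differentiable: "\<delta> \<ge> 0 \<Longrightarrow> \<delta> > 0 \<or> p \<noteq> 0 \<Longrightarrow> grad \<delta> differentiable (at p)"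
  by (rule differentiableI[OF has_derivative_grad])

text \<open>This is the second derivative of half a square: the square of the first derivative of
  \<open>\<gamma>\<close> plus \<open>\<gamma>\<close> times its second derivative. The square forms
  because the inner sum over \<open>k\<close> does not depend on \<open>l\<close> and factors
  out.\<close>

lemma inner_hess:
  "q \<bullet> hess \<delta> p q = (\<Sum>l=1..L. (G l *v p) \<bullet> q / g \<delta> l p)\<^sup>2
     + (\<Sum>l=1..L. \<gamma> \<delta> p / g \<delta> l p * (q \<bullet> (G l *v q) - ((G l *v p) \<bullet> q / g \<delta> l p)\<^sup>2))"
proof -
  define S where "S = (\<Sum>l=1..L. (G l *v p) \<bullet> q / g \<delta> l p)"
  have "q \<bullet> hess \<delta> p q = (\<Sum>l=1..L. S * ((G l *v p) \<bullet> q / g \<delta> l p)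
     + \<gamma> \<delta> p / g \<delta> l p * (q \<bullet> (G l *v q) - ((G l *v p) \<bullet> q / g \<delta> l p)\<^sup>2))"
    unfolding hess_def S_def[symmetric] inner_sum_right
    by (intro sum.cong refl)
      (simp add: inner_add_right inner_diff_right inner_commute algebra_simps power2_eq_square power3_eq_cube)
  also have "\<dots> = S\<^sup>2 + (\<Sum>l=1..L. \<gamma> \<delta> p / g \<delta> l p * (q \<bullet> (G l *v q) - ((G l *v p) \<bullet> q / g \<delta> l p)\<^sup>2))"
    unfolding sum.distrib sum_distrib_left[symmetric] S_def[symmetric] by (simp add: power2_eq_square)
  finally show ?thesis
    unfolding S_def .
qed

text \<open>
  With \<open>a\<^sub>l = G\<^sub>l p \<bullet> q / g\<^sub>l\<close> and \<open>v\<^sub>l = q - (a\<^sub>l / g\<^sub>l) p\<close>, the quantity \<open>q \<bullet> G\<^sub>l q - a\<^sub>l\<^sup>2\<close> is at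
  least \<open>v\<^sub>l \<bullet> G\<^sub>l v\<^sub>l\<close>, and \<open>q = \<Sum>\<^sub>l (g\<^sub>l / \<gamma>) v\<^sub>l + (\<Sum>\<^sub>l a\<^sub>l / \<gamma>) p\<close>.
\<close>

lemma hess_lower:
  assumes "\<delta> \<ge> 0" "\<delta> > 0 \<or> p \<noteq> 0"
  shows "m / 2 * (norm q)\<^sup>2 \<le> q \<bullet> hess \<delta> p q"
proof -
  define a where "a l = (G l *v p) \<bullet> q / g \<delta> l p" for l
  define v where "v l = q - (a l / g \<delta> l p) *\<^sub>R p" for l
  define e where "e l = \<gamma> \<delta> p / g \<delta> l p * (q \<bullet> (G l *v q) - (a l)\<^sup>2)" for l
  define X where "X = (\<Sum>l=1..L. e l)"
  define S where "S = (\<Sum>l=1..L. a l)"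
  have gp: "g \<delta> l p > 0" if "l \<in> {1..L}" for l
    by (rule g_pos[OF that assms])
  have gam: "\<gamma> \<delta> p > 0"
    by (rule gamma_pos[OF assms])
  have v_le_e: "m * (norm (v l))\<^sup>2 \<le> e l" if l: "l \<in> {1..L}" for l
  proof -
    have ag: "(G l *v p) \<bullet> q = a l * g \<delta> l p"
      using gp[OF l] by (simp add: a_def)
    have "v l \<bullet> (G l *v v l) = q \<bullet> (G l *v q) - 2 * (a l / g \<delta> l p) * ((G l *v p) \<bullet> q)
        + (a l / g \<delta> l p)\<^sup>2 * (p \<bullet> (G l *v p))"
      unfolding v_def
      by (simp add: matrix_vector_mult_diff_distrib matrix_vector_mult_scaleR inner_diff_left
          inner_diff_right sym[OF l, of p, symmetric] inner_commute[of q] algebra_simps power2_eq_square)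
    \<comment> \<open>The last term of the expansion is \<open>(a l)\<^sup>2\<close> up to a
      correction, since the quadratic form at \<open>p\<close> equals the square of \<open>g\<close>
      minus \<open>\<delta>\<close>. The correction carries a favourable sign and is dropped
      next.\<close>
    also have "\<dots> = q \<bullet> (G l *v q) - (a l)\<^sup>2 - (a l / g \<delta> l p)\<^sup>2 * \<delta>"
    proof -
      have pGp: "p \<bullet> (G l *v p) = (g \<delta> l p)\<^sup>2 - \<delta>"
        using g_sq[OF l assms(1), of p] by simp
      show ?thesis
        unfolding ag pGp using gp[OF l] by (simp add: field_simps power2_eq_square)
    qed
    also have "\<dots> \<le> q \<bullet> (G l *v q) - (a l)\<^sup>2"
      using assms(1) by simp
    finally have bound: "m * (norm (v l))\<^sup>2 \<le> q \<bullet> (G l *v q) - (a l)\<^sup>2"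
      using lower[OF l, of "v l"] by linarith
    moreover have "1 \<le> \<gamma> \<delta> p / g \<delta> l p"
      using gamma_ge_g[OF l assms(1), of p] gp[OF l] by simp
    moreover have "0 \<le> m * (norm (v l))\<^sup>2"
      using m_pos by simp
    \<comment> \<open>The weight is at least 1 and the bracket is nonnegative, so replacing the
      weight by 1 only decreases the product.\<close>
    ultimately have "1 * (q \<bullet> (G l *v q) - (a l)\<^sup>2) \<le> e l"
      unfolding e_def by (intro mult_right_mono) auto
    with bound show ?thesis
      by simp
  qed
  have e_nonneg: "0 \<le> e l" if "l \<in> {1..L}" for l
    using v_le_e[OF that] m_pos by (meson mult_nonneg_nonneg order.trans less_imp_le zero_le_power2)
  have "X \<ge> 0"
    unfolding X_def using e_nonneg by (rule sum_nonneg)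
  \<comment> \<open>Each nonnegative \<open>e l\<close> is at most the whole sum \<open>X\<close>,
    so one radius serves for all \<open>v l\<close>.\<close>
  have v_le: "norm (v l) \<le> sqrt (X / m)" if l: "l \<in> {1..L}" for l
  proof (rule real_le_rsqrt)
    have "e l \<le> X"
      unfolding X_def using e_nonneg l by (intro member_le_sum) auto
    then show "(norm (v l))\<^sup>2 \<le> X / m"
      using v_le_e[OF l] m_pos by (simp add: field_simps)
  qed
  \<comment> \<open>These weights are nonnegative with sum 1, so the weighted average of the
    \<open>v l\<close> stays within the same radius.\<close>
  have weights: "(\<Sum>l=1..L. g \<delta> l p / \<gamma> \<delta> p) = 1"
    using gam unfolding sum_divide_distrib[symmetric] gamma_sum_def by simp
  have "(\<Sum>l=1..L. (g \<delta> l p / \<gamma> \<delta> p) *\<^sub>R v l)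
      = (\<Sum>l=1..L. (g \<delta> l p / \<gamma> \<delta> p) *\<^sub>R q) - (\<Sum>l=1..L. (a l / \<gamma> \<delta> p) *\<^sub>R p)"
    unfolding sum_subtractf[symmetric]
  proof (intro sum.cong refl)
    fix l assume "l \<in> {1..L}"
    then show "(g \<delta> l p / \<gamma> \<delta> p) *\<^sub>R v l = (g \<delta> l p / \<gamma> \<delta> p) *\<^sub>R q - (a l / \<gamma> \<delta> p) *\<^sub>R p"
      using gp[of l] by (simp add: v_def scaleR_right_diff_distrib)
  qed
  also have "\<dots> = q - (S / \<gamma> \<delta> p) *\<^sub>R p"
    unfolding scaleR_sum_left[symmetric] weights S_def sum_divide_distrib by simp
  finally have "q = (\<Sum>l=1..L. (g \<delta> l p / \<gamma> \<delta> p) *\<^sub>R v l) + (S / \<gamma> \<delta> p) *\<^sub>R p"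
    by simp
  then have "norm q \<le> norm (\<Sum>l=1..L. (g \<delta> l p / \<gamma> \<delta> p) *\<^sub>R v l) + norm ((S / \<gamma> \<delta> p) *\<^sub>R p)"
    by (metis norm_triangle_ineq)
  also have "norm (\<Sum>l=1..L. (g \<delta> l p / \<gamma> \<delta> p) *\<^sub>R v l)
      \<le> (\<Sum>l=1..L. g \<delta> l p / \<gamma> \<delta> p * sqrt (X / m))"
  proof (rule sum_norm_le)
    fix l assume l: "l \<in> {1..L}"
    show "norm ((g \<delta> l p / \<gamma> \<delta> p) *\<^sub>R v l) \<le> g \<delta> l p / \<gamma> \<delta> p * sqrt (X / m)"
      using v_le[OF l] gp[OF l] gam by (simp add: divide_right_mono)
  qed
  also have "\<dots> = sqrt (X / m)"
    unfolding sum_distrib_right[symmetric] weights by simp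
  also have "norm ((S / \<gamma> \<delta> p) *\<^sub>R p) \<le> \<bar>S\<bar> / sqrt m"
  proof -
    have "norm p / \<gamma> \<delta> p \<le> 1 / sqrt m"
      using norm_le_gamma[OF assms(1), of p] gam m_pos by (simp add: field_simps)
    then have "\<bar>S\<bar> * (norm p / \<gamma> \<delta> p) \<le> \<bar>S\<bar> * (1 / sqrt m)"
      by (intro mult_left_mono) auto
    then show ?thesis
      using gam by simp
  qed
  finally have "norm q \<le> (sqrt X + \<bar>S\<bar>) / sqrt m"
    by (simp add: real_sqrt_divide add_divide_distrib)
  then have "(norm q)\<^sup>2 \<le> ((sqrt X + \<bar>S\<bar>) / sqrt m)\<^sup>2"
    by (intro power_mono) auto
  also have "\<dots> = (sqrt X + \<bar>S\<bar>)\<^sup>2 / m"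
    using m_pos by (simp add: power_divide)
  \<comment> \<open>Squaring a sum of two terms costs a factor 2, which is why the coercivity
    constant is \<open>m / 2\<close>.\<close>
  also have "\<dots> \<le> 2 * (X + S\<^sup>2) / m"
  proof (rule divide_right_mono)
    have "0 \<le> (sqrt X - \<bar>S\<bar>)\<^sup>2"
      by simp
    then show "(sqrt X + \<bar>S\<bar>)\<^sup>2 \<le> 2 * (X + S\<^sup>2)"
      using \<open>X \<ge> 0\<close> by (simp add: power2_sum power2_diff)
  qed (use m_pos in simp)
  finally have "m / 2 * (norm q)\<^sup>2 \<le> S\<^sup>2 + X"
    using m_pos by (simp add: field_simps)
  then show ?thesis
    unfolding inner_hess S_def X_def e_def a_def .
qed

text \<open>A bound for \<open>L\<close> equal summands. With K = \<open>M / sqrt m\<close> and k =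
  \<open>sqrt (M / m)\<close>, the three pieces of each summand of \<open>hess\<close> contribute L
  K^2, L k M and L k K^2.\<close>

definition hess_const :: real where
  "hess_const = L * ((L + L * sqrt (M / m)) * (M / sqrt m)\<^sup>2 + L * sqrt (M / m) * M)"

lemma hess_const_pos: "hess_const > 0"
  using m_pos M_pos L_ge_1 unfolding hess_const_def
  by (intro mult_pos_pos add_nonneg_pos mult_nonneg_nonneg) auto

text \<open>Each piece is a product of the scale-free quotients
  \<open>norm (G l *v p) / g \<delta> l p\<close> and
  \<open>\<gamma> \<delta> p / g \<delta> l p\<close>, both uniformly bounded, with one factor
  linear in \<open>q\<close>.\<close>

lemma norm_hess_le:
  assumes "\<delta> \<ge> 0" "\<delta> > 0 \<or> p \<noteq> 0"
  shows "norm (hess \<delta> p q) \<le> hess_const * norm q"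
proof -
  define K where "K = M / sqrt m"
  define \<kappa> where "\<kappa> = sqrt (M / m)"
  define S where "S = (\<Sum>l=1..L. (G l *v p) \<bullet> q / g \<delta> l p)"
  have K: "K > 0" and \<kappa>: "\<kappa> > 0"
    using M_pos m_pos by (auto simp: K_def \<kappa>_def)
  have gp: "g \<delta> l p > 0" if "l \<in> {1..L}" for l
    by (rule g_pos[OF that assms])
  have Gp: "norm (G l *v p) / g \<delta> l p \<le> K" if l: "l \<in> {1..L}" for l
    using norm_G_le_g[OF l assms(1), of p] gp[OF l] by (simp add: K_def field_simps)
  have gam: "\<gamma> \<delta> p / g \<delta> l p \<le> L * \<kappa>" if l: "l \<in> {1..L}" for l
    using gamma_comparable[OF l assms(1), of p] gp[OF l] by (simp add: \<kappa>_def field_simps)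
  have gam0: "0 \<le> \<gamma> \<delta> p / g \<delta> l p" if l: "l \<in> {1..L}" for l
    using gamma_nonneg[OF assms(1), of p] gp[OF l] by simp
  have a: "\<bar>(G l *v p) \<bullet> q / g \<delta> l p\<bar> \<le> K * norm q" if l: "l \<in> {1..L}" for l
  proof -
    have "\<bar>(G l *v p) \<bullet> q / g \<delta> l p\<bar> \<le> norm (G l *v p) / g \<delta> l p * norm q"
      using Cauchy_Schwarz_ineq2[of "G l *v p" q] gp[OF l] by (simp add: divide_right_mono)
    also have "\<dots> \<le> K * norm q"
      using Gp[OF l] by (intro mult_right_mono) auto
    finally show ?thesis .
  qed
  have "\<bar>S\<bar> \<le> (\<Sum>l=1..L. K * norm q)"
    unfolding S_def by (rule order.trans[OF sum_abs sum_mono[OF a]])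
  then have S: "\<bar>S\<bar> \<le> L * K * norm q"
    by simp
  have "norm (hess \<delta> p q) \<le> (\<Sum>l=1..L. ((L + L * \<kappa>) * K\<^sup>2 + L * \<kappa> * M) * norm q)"
    unfolding hess_def S_def[symmetric]
  proof (rule sum_norm_le)
    fix l assume l: "l \<in> {1..L}"
    have 1: "norm ((S / g \<delta> l p) *\<^sub>R (G l *v p)) \<le> (L * K * norm q) * K"
    proof -
      have "norm ((S / g \<delta> l p) *\<^sub>R (G l *v p)) = \<bar>S\<bar> * (norm (G l *v p) / g \<delta> l p)"
        using gp[OF l] by simp
      also have "\<dots> \<le> (L * K * norm q) * K"
        using S Gp[OF l] gp[OF l] K by (intro mult_mono) auto
      finally show ?thesis .
    qed
    have 2: "norm ((\<gamma> \<delta> p / g \<delta> l p) *\<^sub>R (G l *v q)) \<le> (L * \<kappa>) * (M * norm q)"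
      unfolding norm_scaleR abs_of_nonneg[OF gam0[OF l]]
      using gam[OF l] upper[OF l, of q] \<kappa> by (intro mult_mono) auto
    have 3: "norm ((\<gamma> \<delta> p * ((G l *v p) \<bullet> q) / g \<delta> l p ^ 3) *\<^sub>R (G l *v p)) \<le> (L * \<kappa>) * (K * norm q) * K"
    proof -
      have "norm ((\<gamma> \<delta> p * ((G l *v p) \<bullet> q) / g \<delta> l p ^ 3) *\<^sub>R (G l *v p))
          = (\<gamma> \<delta> p / g \<delta> l p) * \<bar>(G l *v p) \<bullet> q / g \<delta> l p\<bar> * (norm (G l *v p) / g \<delta> l p)"
        using gp[OF l] gamma_nonneg[OF assms(1), of p] by (simp add: abs_mult power3_eq_cube)
      also have "\<dots> \<le> (L * \<kappa>) * (K * norm q) * K"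
        using gam[OF l] a[OF l] Gp[OF l] gp[OF l] K \<kappa>
        by (intro mult_mono) auto
      finally show ?thesis .
    qed
    have "norm ((S / g \<delta> l p) *\<^sub>R (G l *v p) + (\<gamma> \<delta> p / g \<delta> l p) *\<^sub>R (G l *v q)
        - (\<gamma> \<delta> p * ((G l *v p) \<bullet> q) / g \<delta> l p ^ 3) *\<^sub>R (G l *v p))
       \<le> (L * K * norm q) * K + (L * \<kappa>) * (M * norm q) + (L * \<kappa>) * (K * norm q) * K"
      by (rule norm_triangle_le_diff add_mono norm_triangle_le 1 2 3)+
    then show "norm ((S / g \<delta> l p) *\<^sub>R (G l *v p) + (\<gamma> \<delta> p / g \<delta> l p) *\<^sub>R (G l *v q)
        - (\<gamma> \<delta> p * ((G l *v p) \<bullet> q) / g \<delta> l p ^ 3) *\<^sub>R (G l *v p))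
       \<le> ((L + L * \<kappa>) * K\<^sup>2 + L * \<kappa> * M) * norm q"
      by (simp add: algebra_simps power2_eq_square)
  qed
  then show ?thesis
    by (simp add: hess_const_def K_def \<kappa>_def)
qed

lemma hess_upper:
  assumes "\<delta> \<ge> 0" "\<delta> > 0 \<or> p \<noteq> 0"
  shows "q \<bullet> hess \<delta> p q \<le> hess_const * (norm q)\<^sup>2"
proof -
  have "q \<bullet> hess \<delta> p q \<le> norm q * norm (hess \<delta> p q)"
    by (rule norm_cauchy_schwarz)
  also have "\<dots> \<le> norm q * (hess_const * norm q)"
    using norm_hess_le[OF assms] by (intro mult_left_mono) auto
  finally show ?thesis
    by (simp add: power2_eq_square algebra_simps)
qed

text \<open>Links the matrix of the statement to the linear map \<open>hess\<close>, on which all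
  estimates are made.\<close>

lemma hessian_mult:
  assumes "\<delta> \<ge> 0" "\<delta> > 0 \<or> p \<noteq> 0"
  shows "hessian (aniso L G \<delta>) p *v q = hess \<delta> p q"
proof -
  have "frechet_derivative (grad \<delta>) (at p) = hess \<delta> p"
    using frechet_derivative_at[OF has_derivative_grad[OF assms]] by simp
  then show ?thesis
    unfolding hessian_def jacobian_def gradient_aniso[OF assms(1)]
    using matrix_vector_mul(2)[OF has_derivative_linear[OF has_derivative_grad[OF assms]]]
    by metis
qed

lemma hessian_at_0:
  assumes "\<delta> > 0"
  shows "hessian (aniso L G \<delta>) 0 = real L *\<^sub>R (\<Sum>l=1..L. G l)"
proof -
  have "hessian (aniso L G \<delta>) 0 *v q = (real L *\<^sub>R (\<Sum>l=1..L. G l)) *v q" for q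
  proof -
    \<comment> \<open>At the origin every root equals \<open>sqrt \<delta>\<close>, whatever its
      index, and the two pieces of \<open>hess\<close> containing \<open>G l *v p\<close>
      vanish.\<close>
    have "\<gamma> \<delta> 0 / g \<delta> l 0 = L" for l
      using assms by (simp add: gamma_sum_def gamma_comp_def)
    moreover have "(\<Sum>l\<in>I. G l) *v q = (\<Sum>l\<in>I. G l *v q)" for I
      by (induction I rule: infinite_finite_induct) (auto simp: matrix_vector_mult_add_rdistrib)
    then have "(real L *\<^sub>R (\<Sum>l=1..L. G l)) *v q = (\<Sum>l=1..L. real L *\<^sub>R (G l *v q))"
      unfolding scaleR_matrix_vector_assoc[symmetric] by (simp add: scaleR_sum_right)
    ultimately show ?thesis
      using assms by (simp add: hessian_mult hess_def)
  qed
  then show ?thesis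
    by (simp add: matrix_eq)
qed

end

section \<open>Hoelder continuity of the gradient in the regularization parameter\<close>

lemma abs_sqrt_diff_le:
  assumes "0 \<le> a" "0 \<le> b"
  shows "\<bar>sqrt a - sqrt b\<bar> \<le> sqrt \<bar>a - b\<bar>"
proof -
  \<comment> \<open>Subadditivity of the square root; it yields the exponent 1/2.\<close>
  have "sqrt x - sqrt y \<le> sqrt (x - y)" if "0 \<le> y" "y \<le> x" for x y
    using sqrt_add_le_add_sqrt[of "x - y" y] that by simp
  from this[of a b] this[of b a] show ?thesis
    using assms by (cases "a \<le> b") (auto simp: abs_real_def)
qed

context aniso_bounds
begin

definition holder_const :: real where
  "holder_const = L * (L * (1 + sqrt (M / m)) * (M / sqrt m))"

lemma holder_const_pos: "holder_const > 0"
  using m_pos M_pos L_ge_1 unfolding holder_const_def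
  by (intro mult_pos_pos add_pos_nonneg) auto

text \<open>Only the weights depend on the parameter. Their difference is of order
  \<open>s / g \<delta> l p\<close>, possibly large near the origin, but it multiplies
  \<open>G l *v p\<close>, whose norm is at most a constant times \<open>g \<delta> l p\<close>. At
  \<open>p = 0\<close> both gradients vanish, whereas a denominator could be zero.\<close>

lemma grad_holder:
  assumes "0 \<le> \<delta>" "0 \<le> \<epsilon>"
  shows "norm (grad \<delta> p - grad \<epsilon> p) \<le> holder_const * sqrt \<bar>\<delta> - \<epsilon>\<bar>"
proof (cases "p = 0")
  case True
  then show ?thesis
    using holder_const_pos by simp
next
  case False
  define s where "s = sqrt \<bar>\<delta> - \<epsilon>\<bar>"
  define K where "K = M / sqrt m"
  define \<kappa> where "\<kappa> = sqrt (M / m)"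
  have K: "K > 0" and \<kappa>: "\<kappa> > 0" and s: "s \<ge> 0"
    using M_pos m_pos by (auto simp: K_def \<kappa>_def s_def)
  have gp: "g \<delta> l p > 0" "g \<epsilon> l p > 0" if "l \<in> {1..L}" for l
    using g_pos[OF that] False assms by auto
  have gdiff: "\<bar>g \<delta> l p - g \<epsilon> l p\<bar> \<le> s" if l: "l \<in> {1..L}" for l
    using abs_sqrt_diff_le[of "p \<bullet> (G l *v p) + \<delta>" "p \<bullet> (G l *v p) + \<epsilon>"] quad_nonneg[OF l, of p] assms
    by (simp add: gamma_comp_def s_def)
  have "\<bar>\<gamma> \<delta> p - \<gamma> \<epsilon> p\<bar> \<le> (\<Sum>l=1..L. s)"
    unfolding gamma_sum_def sum_subtractf[symmetric] by (rule order.trans[OF sum_abs sum_mono[OF gdiff]])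
  then have gamdiff: "\<bar>\<gamma> \<delta> p - \<gamma> \<epsilon> p\<bar> \<le> L * s"
    by simp
  have "norm (\<Sum>l=1..L. (\<gamma> \<delta> p / g \<delta> l p - \<gamma> \<epsilon> p / g \<epsilon> l p) *\<^sub>R (G l *v p))
      \<le> (\<Sum>l=1..L. L * (1 + \<kappa>) * K * s)"
  proof (rule sum_norm_le)
    fix l assume l: "l \<in> {1..L}"
    have ratio: "0 \<le> \<gamma> \<epsilon> p / g \<epsilon> l p" "\<gamma> \<epsilon> p / g \<epsilon> l p \<le> L * \<kappa>"
      using gamma_comparable[OF l assms(2), of p] gamma_nonneg[OF assms(2), of p] gp(2)[OF l]
      by (auto simp: \<kappa>_def field_simps)
    \<comment> \<open>The difference is arranged so that only \<open>g \<delta> l p\<close> remains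
      as a bare denominator; the other one occurs in a bounded ratio.\<close>
    have "\<gamma> \<delta> p / g \<delta> l p - \<gamma> \<epsilon> p / g \<epsilon> l p
        = ((\<gamma> \<delta> p - \<gamma> \<epsilon> p) + \<gamma> \<epsilon> p / g \<epsilon> l p * (g \<epsilon> l p - g \<delta> l p)) / g \<delta> l p"
      using gp[OF l] by (simp add: field_simps)
    also have "\<bar>\<dots>\<bar> \<le> (L * s + L * \<kappa> * s) / g \<delta> l p"
    proof -
      have "\<bar>\<gamma> \<epsilon> p / g \<epsilon> l p * (g \<epsilon> l p - g \<delta> l p)\<bar> \<le> L * \<kappa> * s"
        unfolding abs_mult using ratio gdiff[OF l] \<kappa> by (intro mult_mono) auto
      then have "\<bar>(\<gamma> \<delta> p - \<gamma> \<epsilon> p) + \<gamma> \<epsilon> p / g \<epsilon> l p * (g \<epsilon> l p - g \<delta> l p)\<bar> \<le> L * s + L * \<kappa> * s"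
        using gamdiff by (intro order.trans[OF abs_triangle_ineq] add_mono)
      then show ?thesis
        using gp(1)[OF l] by (simp add: divide_right_mono)
    qed
    finally have "\<bar>\<gamma> \<delta> p / g \<delta> l p - \<gamma> \<epsilon> p / g \<epsilon> l p\<bar> * norm (G l *v p)
        \<le> (L * s + L * \<kappa> * s) / g \<delta> l p * (K * g \<delta> l p)"
      using norm_G_le_g[OF l assms(1), of p] gp(1)[OF l] s \<kappa>
      by (intro mult_mono) (auto simp: K_def)
    also have "\<dots> = L * (1 + \<kappa>) * K * s"
      using gp(1)[OF l] by (simp add: field_simps)
    finally show "norm ((\<gamma> \<delta> p / g \<delta> l p - \<gamma> \<epsilon> p / g \<epsilon> l p) *\<^sub>R (G l *v p)) \<le> L * (1 + \<kappa>) * K * s"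
      by simp
  qed
  then show ?thesis
    by (simp add: grad_def sum_subtractf scaleR_left_diff_distrib holder_const_def K_def \<kappa>_def s_def algebra_simps)
qed

section \<open>Lipschitz continuity and strong monotonicity of the gradient\<close>

lemma grad_tendsto_0: "((\<lambda>\<delta>. grad \<delta> p) \<longlongrightarrow> grad 0 p) (at_right 0)"
proof (rule Lim_null[THEN iffD2], rule Lim_null_comparison)
  show "\<forall>\<^sub>F \<delta> in at_right 0. norm (grad \<delta> p - grad 0 p) \<le> holder_const * sqrt \<delta>"
    using grad_holder[of _ 0 p] by (intro eventually_at_right_less[THEN eventually_mono]) auto
  show "((\<lambda>\<delta>. holder_const * sqrt \<delta>) \<longlongrightarrow> 0) (at_right 0)"
    by (auto intro!: tendsto_eq_intros)
qed

text \<open>For \<open>\<delta> > 0\<close> the mean value inequality applies on the whole space. At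
  \<open>\<delta> = 0\<close> differentiability is available only away from the origin, which a
  segment may meet; the bound is free of \<open>\<delta>\<close> and survives the limit
  instead.\<close>

lemma grad_lipschitz:
  assumes "\<delta> \<ge> 0"
  shows "norm (grad \<delta> p - grad \<delta> q) \<le> hess_const * norm (p - q)"
proof -
  have pos: "norm (grad \<delta> p - grad \<delta> q) \<le> hess_const * norm (p - q)" if "\<delta> > 0" for \<delta>
  proof (rule differentiable_bound[of UNIV _ "hess \<delta>"])
    show "onorm (hess \<delta> x) \<le> hess_const" for x
      using norm_hess_le[of \<delta> x] that by (intro onorm_le) auto
  qed (use has_derivative_grad that in auto)
  have "norm (grad 0 p - grad 0 q) \<le> hess_const * norm (p - q)"
  proof (rule tendsto_upperbound)
    show "((\<lambda>\<delta>. norm (grad \<delta> p - grad \<delta> q)) \<longlongrightarrow> norm (grad 0 p - grad 0 q)) (at_right 0)"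
      by (intro tendsto_intros grad_tendsto_0)
    show "\<forall>\<^sub>F \<delta> in at_right 0. norm (grad \<delta> p - grad \<delta> q) \<le> hess_const * norm (p - q)"
      using pos by (intro eventually_at_right_less[THEN eventually_mono])
  qed simp
  with pos[of \<delta>] assms show ?thesis
    by (cases "\<delta> = 0") auto
qed

lemma grad_monotone:
  assumes "\<delta> \<ge> 0"
  shows "m / 2 * (norm (p - q))\<^sup>2 \<le> (grad \<delta> p - grad \<delta> q) \<bullet> (p - q)"
proof -
  have pos: "m / 2 * (norm (p - q))\<^sup>2 \<le> (grad \<delta> p - grad \<delta> q) \<bullet> (p - q)" if d: "\<delta> > 0" for \<delta>
  proof -
    \<comment> \<open>Taking the inner product with \<open>p - q\<close> along the segment gives a
      real function, to which the mean value theorem applies as an equality.\<close>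
    define y where "y s = q + s *\<^sub>R (p - q)" for s :: real
    have line: "((\<lambda>s. grad \<delta> (y s) \<bullet> (p - q)) has_derivative
        (\<lambda>h. hess \<delta> (y s) (h *\<^sub>R (p - q)) \<bullet> (p - q))) (at s within {0..1})" for s
    proof -
      have "(y has_derivative (\<lambda>h. h *\<^sub>R (p - q))) (at s within {0..1})"
        unfolding y_def by (auto intro!: derivative_eq_intros)
      from has_derivative_compose[OF this has_derivative_grad] d show ?thesis
        by (intro has_derivative_inner_left) simp
    qed
    obtain s where "grad \<delta> (y 1) \<bullet> (p - q) - grad \<delta> (y 0) \<bullet> (p - q)
        = hess \<delta> (y s) ((1 - 0) *\<^sub>R (p - q)) \<bullet> (p - q)"
      using mvt_very_simple[of 0 1, OF _ line] by auto
    then show ?thesis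
      using hess_lower[of \<delta> "y s" "p - q"] d
      by (simp add: y_def inner_diff_right[of "p - q"] inner_commute)
  qed
  have "m / 2 * (norm (p - q))\<^sup>2 \<le> (grad 0 p - grad 0 q) \<bullet> (p - q)"
  proof (rule tendsto_lowerbound)
    show "((\<lambda>\<delta>. (grad \<delta> p - grad \<delta> q) \<bullet> (p - q)) \<longlongrightarrow> (grad 0 p - grad 0 q) \<bullet> (p - q)) (at_right 0)"
      by (intro tendsto_intros grad_tendsto_0)
    show "\<forall>\<^sub>F \<delta> in at_right 0. m / 2 * (norm (p - q))\<^sup>2 \<le> (grad \<delta> p - grad \<delta> q) \<bullet> (p - q)"
      using pos by (intro eventually_at_right_less[THEN eventually_mono])
  qed simp
  with pos[of \<delta>] assms show ?thesis
    by (cases "\<delta> = 0") auto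
qed

lemma strongly_monotone_const_grad: "\<delta> \<ge> 0 \<Longrightarrow> strongly_monotone_const (m / 2) (grad \<delta>)"
  using grad_monotone m_pos by (auto simp: strongly_monotone_const_def)

lemma lipschitz_on_grad: "\<delta> \<ge> 0 \<Longrightarrow> hess_const-lipschitz_on UNIV (grad \<delta>)"
  using grad_lipschitz hess_const_pos by (auto simp: lipschitz_on_def dist_norm)

lemma norm_grad_le: "\<delta> \<ge> 0 \<Longrightarrow> norm (grad \<delta> p) \<le> hess_const * norm p"
  using grad_lipschitz[of \<delta> p 0] by simp

section \<open>Smoothness classes and boundedness of the Hessian\<close>

lemma aniso_differentiable: "\<delta> \<ge> 0 \<Longrightarrow> aniso L G \<delta> differentiable (at p)"
  using GDERIV_aniso[of \<delta> p] unfolding gderiv_def by (rule differentiableI)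

lemma C1_aniso: "\<delta> \<ge> 0 \<Longrightarrow> C1_function (aniso L G \<delta>)"
  unfolding C1_function_def gradient_aniso
  using aniso_differentiable lipschitz_on_continuous_on[OF lipschitz_on_grad] by blast

text \<open>Reduces continuity and boundedness of the matrix to those of \<open>hess\<close> at
  finitely many coordinate vectors.\<close>

lemma hessian_entry:
  assumes "\<delta> > 0"
  shows "hessian (aniso L G \<delta>) p $ i $ j = hess \<delta> p (axis j 1) $ i"
  using hessian_mult[of \<delta> p "axis j 1"] assms
  by (simp add: matrix_vector_mult_basis column_def vec_eq_iff)

lemma C2_aniso:
  assumes d: "\<delta> > 0"
  shows "C2_function (aniso L G \<delta>)"
proof -
  have g_cont: "continuous_on UNIV (g \<delta> l)" if "l \<in> {1..L}" for l
    using that d has_derivative_continuous[OF has_derivative_g[of l \<delta>]]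
    by (intro continuous_at_imp_continuous_on) auto
  have gam_cont: "continuous_on UNIV (\<gamma> \<delta>)"
    unfolding gamma_sum_def[abs_def] using g_cont by (intro continuous_on_sum)
  have lin_cont: "continuous_on UNIV (\<lambda>p. G l *v p)" for l
    by (rule matrix_vector_mult_linear_continuous_on)
  have g_ne: "g \<delta> l p \<noteq> 0" if "l \<in> {1..L}" for l p
    using g_pos[OF that, of \<delta> p] d by simp
  have "continuous_on UNIV (\<lambda>p. hess \<delta> p q)" for q
    \<comment> \<open>The formula is a combination of continuous functions whose denominators never
      vanish, because \<open>\<delta> > 0\<close>.\<close>
    unfolding hess_def
    by (intro continuous_intros g_cont gam_cont lin_cont) (auto simp: g_ne)
  then have "continuous_on UNIV (\<lambda>p. \<chi> i j. hess \<delta> p (axis j 1) $ i)"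
    by (intro continuous_on_vec_lambda continuous_on_component)
  moreover have "hessian (aniso L G \<delta>) = (\<lambda>p. \<chi> i j. hess \<delta> p (axis j 1) $ i)"
    by (simp add: fun_eq_iff vec_eq_iff hessian_entry[OF d])
  ultimately show ?thesis
    unfolding C2_function_def using C1_aniso[of \<delta>] has_derivative_grad[of \<delta>] d
    by (auto simp: gradient_aniso differentiable_def)
qed

lemma bounded_hessian:
  assumes d: "\<delta> > 0"
  shows "bounded (range (hessian (aniso L G \<delta>)))"
proof -
  have "norm (hessian (aniso L G \<delta>) p) \<le> (\<Sum>i\<in>(UNIV::'n set). \<Sum>j\<in>(UNIV::'n set). hess_const)" for p
  proof -
    have entry: "\<bar>hessian (aniso L G \<delta>) p $ i $ j\<bar> \<le> hess_const" for i j
      using component_le_norm_cart[of "hess \<delta> p (axis j 1)" i] norm_hess_le[of \<delta> p "axis j 1"] d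
      by (simp add: hessian_entry)
    \<comment> \<open>The norm of a matrix is a nested Euclidean norm; passing to sums in both
      layers bounds it by the sum of the absolute entries.\<close>
    have "norm (hessian (aniso L G \<delta>) p) \<le> (\<Sum>i\<in>UNIV. norm (hessian (aniso L G \<delta>) p $ i))"
      unfolding norm_vec_def by (rule L2_set_le_sum) simp
    also have "\<dots> \<le> (\<Sum>i\<in>(UNIV::'n set). \<Sum>j\<in>(UNIV::'n set). hess_const)"
      using entry by (intro sum_mono order.trans[OF norm_le_l1_cart])
    finally show ?thesis .
  qed
  then show ?thesis
    by (auto intro!: boundedI)
qed

end

section \<open>Common constants and assembly of the claims\<close>

lemma aniso_bounds_exist:
  fixes G :: "nat \<Rightarrow> real^'n^'n"
  assumes "L \<ge> 1"
    and "\<And>l. l \<in> {1..L} \<Longrightarrow> transpose (G l) = G l"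
    and "\<And>l. l \<in> {1..L} \<Longrightarrow> pos_def_matrix (G l)"
  obtains m M where "aniso_bounds L G m M"
proof -
  have "\<exists>m>0. \<forall>p. m * (norm p)\<^sup>2 \<le> p \<bullet> (G l *v p)" if "l \<in> {1..L}" for l
    using pos_def_matrix_lower_bound[OF assms(3)[OF that]] by metis
  then obtain c where c: "\<And>l. l \<in> {1..L} \<Longrightarrow> c l > 0"
      "\<And>l p. l \<in> {1..L} \<Longrightarrow> c l * (norm p)\<^sup>2 \<le> p \<bullet> (G l *v p)"
    by metis
  \<comment> \<open>There are finitely many matrices and, as \<open>L \<ge> 1\<close>, at least one,
    so the smallest coercivity constant is still positive and the largest operator norm serves all
    of them.\<close>
  define m where "m = Min (c ` {1..L})"
  define M where "M = Max ((\<lambda>l. onorm ((*v) (G l))) ` {1..L})"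
  have "aniso_bounds L G m M"
  proof
    show "L \<ge> 1"
      by fact
    show "(G l *v p) \<bullet> q = p \<bullet> (G l *v q)" if "l \<in> {1..L}" for l p q
      using assms(2)[OF that] by (metis dot_lmul_matrix transpose_matrix_vector)
    show "m > 0"
      using c(1) assms(1) by (auto simp: m_def)
    show "m * (norm p)\<^sup>2 \<le> p \<bullet> (G l *v p)" if "l \<in> {1..L}" for l p
    proof -
      have "m \<le> c l"
        unfolding m_def using that by (intro Min_le) auto
      then have "m * (norm p)\<^sup>2 \<le> c l * (norm p)\<^sup>2"
        by (intro mult_right_mono) auto
      with c(2)[OF that, of p] show ?thesis
        by linarith
    qed
    show "norm (G l *v p) \<le> M * norm p" if "l \<in> {1..L}" for l p
    proof -
      have "norm (G l *v p) \<le> onorm ((*v) (G l)) * norm p"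
        by (rule onorm) (simp add: matrix_vector_mul_bounded_linear)
      also have "\<dots> \<le> M * norm p"
        unfolding M_def using that by (intro mult_right_mono Max_ge) auto
      finally show ?thesis .
    qed
  qed
  then show thesis
    by (rule that)
qed

theorem lemma4p1:
  fixes L :: nat and G :: "nat \<Rightarrow> real^'n^'n"
  assumes "L \<ge> 1"
    and "\<And>l. l \<in> {1..L} \<Longrightarrow> transpose (G l) = G l"
    and "\<And>l. l \<in> {1..L} \<Longrightarrow> pos_def_matrix (G l)"
  shows "(\<exists>c>0. \<exists>C>0. \<forall>\<delta>\<ge>0. \<exists>C\<delta>>0. \<forall>p.
        c * (norm p)\<^sup>2 \<le> aniso L G \<delta> p \<and> aniso L G \<delta> p \<le> C\<delta> + C * (norm p)\<^sup>2)
    \<and> ((\<forall>\<delta>\<ge>0. \<forall>p. aniso L G \<delta> differentiable (at p))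
      \<and> (\<exists>C. \<forall>\<delta>\<ge>0. C-lipschitz_on UNIV (gradient (aniso L G \<delta>)))
      \<and> (\<exists>c. \<forall>\<delta>\<ge>0. strongly_monotone_const c (gradient (aniso L G \<delta>)))
      \<and> (\<forall>\<delta>\<ge>0. gradient (aniso L G \<delta>) 0 = 0))
    \<and> ((\<forall>\<delta>>0. \<forall>p. gradient (aniso L G \<delta>) differentiable (at p))
      \<and> (\<forall>p. p \<noteq> 0 \<longrightarrow> gradient (aniso L G 0) differentiable (at p))
      \<and> (\<exists>c\<^sub>0>0. \<exists>C>0.
          (\<forall>\<delta>>0. \<forall>p q. c\<^sub>0 * (norm q)\<^sup>2 \<le> q \<bullet> (hessian (aniso L G \<delta>) p *v q)
             \<and> q \<bullet> (hessian (aniso L G \<delta>) p *v q) \<le> C * (norm q)\<^sup>2)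
        \<and> (\<forall>p q. p \<noteq> 0 \<longrightarrow> c\<^sub>0 * (norm q)\<^sup>2 \<le> q \<bullet> (hessian (aniso L G 0) p *v q)
             \<and> q \<bullet> (hessian (aniso L G 0) p *v q) \<le> C * (norm q)\<^sup>2))
      \<and> (\<forall>\<delta>>0. hessian (aniso L G \<delta>) 0 = real L *\<^sub>R (\<Sum>l=1..L. G l)))
    \<and> (\<exists>C>0. (\<forall>p. holder_on C (1/2) {0..} (\<lambda>\<delta>. gradient (aniso L G \<delta>) p))
      \<and> (\<forall>p. \<forall>\<delta>>0. norm (gradient (aniso L G \<delta>) p - gradient (aniso L G 0) p) \<le> C * sqrt \<delta>))
    \<and> ((\<forall>\<delta>>0. C2_function (aniso L G \<delta>)
          \<and> bounded (range (hessian (aniso L G \<delta>)))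
          \<and> strongly_monotone (gradient (aniso L G \<delta>)))
      \<and> (\<exists>C>0. \<forall>\<delta>>0. \<forall>p. norm (gradient (aniso L G \<delta>) p) \<le> C * norm p))
    \<and> (C1_function (aniso L G 0)
      \<and> strongly_monotone (gradient (aniso L G 0))
      \<and> (\<exists>C>0. \<forall>p. norm (gradient (aniso L G 0) p) \<le> C * norm p))
    \<and> ((\<exists>c. \<forall>\<delta>>0. strongly_monotone_const c (gradient (aniso L G \<delta>)))
      \<and> (\<exists>\<eta> :: real \<Rightarrow> real. (\<eta> \<longlongrightarrow> 0) (at_right 0)
          \<and> (\<forall>\<delta>>0. \<forall>p. norm (gradient (aniso L G \<delta>) p - gradient (aniso L G 0) p) \<le> \<eta> \<delta>)))"
proof -
  obtain m M where "aniso_bounds L G m M"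
    using aniso_bounds_exist[OF assms] .
  then interpret aniso_bounds L G m M .
  show ?thesis
  proof (intro conjI)
    show "\<exists>c>0. \<exists>C>0. \<forall>\<delta>\<ge>0. \<exists>C\<delta>>0. \<forall>p.
        c * (norm p)\<^sup>2 \<le> aniso L G \<delta> p \<and> aniso L G \<delta> p \<le> C\<delta> + C * (norm p)\<^sup>2"
    proof -
      have "\<exists>C\<delta>>0. \<forall>p. m / 2 * (norm p)\<^sup>2 \<le> aniso L G \<delta> p
          \<and> aniso L G \<delta> p \<le> C\<delta> + (real L)\<^sup>2 * M / 2 * (norm p)\<^sup>2" if d: "\<delta> \<ge> 0" for \<delta>
      \<comment> \<open>The added 1 keeps this constant positive when \<open>\<delta> = 0\<close>;
        only it depends on \<open>\<delta>\<close>.\<close>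
      proof (intro exI[of _ "(real L)\<^sup>2 * \<delta> / 2 + 1"] conjI allI)
        show "aniso L G \<delta> p \<le> (real L)\<^sup>2 * \<delta> / 2 + 1 + (real L)\<^sup>2 * M / 2 * (norm p)\<^sup>2" for p
          using aniso_upper[OF d, of p] by linarith
      qed (use d aniso_lower in \<open>auto intro: add_nonneg_pos\<close>)
      moreover have "m / 2 > 0" "(real L)\<^sup>2 * M / 2 > 0"
        using m_pos M_pos assms(1) by auto
      ultimately show ?thesis
        by blast
    qed
    show "\<forall>\<delta>\<ge>0. \<forall>p. aniso L G \<delta> differentiable (at p)"
      using aniso_differentiable by blast
    show "\<exists>C. \<forall>\<delta>\<ge>0. C-lipschitz_on UNIV (gradient (aniso L G \<delta>))"
      using lipschitz_on_grad gradient_aniso by metis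
    show mono: "\<exists>c. \<forall>\<delta>\<ge>0. strongly_monotone_const c (gradient (aniso L G \<delta>))"
      using strongly_monotone_const_grad gradient_aniso by metis
    then show "\<exists>c. \<forall>\<delta>>0. strongly_monotone_const c (gradient (aniso L G \<delta>))"
      "strongly_monotone (gradient (aniso L G 0))"
      unfolding strongly_monotone_def by (meson order.refl less_imp_le)+
    show "\<forall>\<delta>\<ge>0. gradient (aniso L G \<delta>) 0 = 0"
      by (simp add: gradient_aniso)
    show "\<forall>\<delta>>0. \<forall>p. gradient (aniso L G \<delta>) differentiable (at p)"
      using grad_differentiable by (simp add: gradient_aniso)
    show "\<forall>p. p \<noteq> 0 \<longrightarrow> gradient (aniso L G 0) differentiable (at p)"
      using grad_differentiable by (simp add: gradient_aniso)
    show "\<exists>c\<^sub>0>0. \<exists>C>0.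
          (\<forall>\<delta>>0. \<forall>p q. c\<^sub>0 * (norm q)\<^sup>2 \<le> q \<bullet> (hessian (aniso L G \<delta>) p *v q)
             \<and> q \<bullet> (hessian (aniso L G \<delta>) p *v q) \<le> C * (norm q)\<^sup>2)
        \<and> (\<forall>p q. p \<noteq> 0 \<longrightarrow> c\<^sub>0 * (norm q)\<^sup>2 \<le> q \<bullet> (hessian (aniso L G 0) p *v q)
             \<and> q \<bullet> (hessian (aniso L G 0) p *v q) \<le> C * (norm q)\<^sup>2)"
    proof -
      \<comment> \<open>The side condition covers both regimes at once, so the same two constants
        serve \<open>\<delta> > 0\<close> with any \<open>p\<close> and \<open>\<delta> = 0\<close>
        with \<open>p \<noteq> 0\<close>.\<close>
      have "m / 2 * (norm q)\<^sup>2 \<le> q \<bullet> (hessian (aniso L G \<delta>) p *v q)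
          \<and> q \<bullet> (hessian (aniso L G \<delta>) p *v q) \<le> hess_const * (norm q)\<^sup>2"
        if "\<delta> \<ge> 0" "\<delta> > 0 \<or> p \<noteq> 0" for \<delta> p q
        unfolding hessian_mult[OF that] using hess_lower[OF that] hess_upper[OF that] by blast
      moreover have "m / 2 > 0"
        using m_pos by simp
      ultimately show ?thesis
        using hess_const_pos by (meson less_imp_le order.refl)
    qed
    show "\<forall>\<delta>>0. hessian (aniso L G \<delta>) 0 = real L *\<^sub>R (\<Sum>l=1..L. G l)"
      using hessian_at_0 by blast
    \<comment> \<open>The case of second parameter 0 in the Hoelder estimate; it supplies both the
      special inequality and the modulus \<open>\<eta>\<close>.\<close>
    have diff_bound: "norm (gradient (aniso L G \<delta>) p - gradient (aniso L G 0) p) \<le> holder_const * sqrt \<delta>"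
      if "\<delta> > 0" for \<delta> p
      using grad_holder[of \<delta> 0 p] that by (simp add: gradient_aniso)
    show "\<exists>C>0. (\<forall>p. holder_on C (1/2) {0..} (\<lambda>\<delta>. gradient (aniso L G \<delta>) p))
      \<and> (\<forall>p. \<forall>\<delta>>0. norm (gradient (aniso L G \<delta>) p - gradient (aniso L G 0) p) \<le> C * sqrt \<delta>)"
    proof (intro exI[of _ holder_const] conjI allI impI)
      show "holder_on holder_const (1/2) {0..} (\<lambda>\<delta>. gradient (aniso L G \<delta>) p)" for p
        using grad_holder by (auto simp: holder_on_def gradient_aniso dist_norm powr_half_sqrt)
    qed (use holder_const_pos diff_bound in auto)
    show "\<exists>\<eta>::real \<Rightarrow> real. (\<eta> \<longlongrightarrow> 0) (at_right 0)
          \<and> (\<forall>\<delta>>0. \<forall>p. norm (gradient (aniso L G \<delta>) p - gradient (aniso L G 0) p) \<le> \<eta> \<delta>)"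
    proof (intro exI[of _ "\<lambda>\<delta>. holder_const * sqrt \<delta>"] conjI allI impI)
      show "((\<lambda>\<delta>. holder_const * sqrt \<delta>) \<longlongrightarrow> 0) (at_right 0)"
        by (auto intro!: tendsto_eq_intros)
    qed (use diff_bound in auto)
    show "\<forall>\<delta>>0. C2_function (aniso L G \<delta>)
          \<and> bounded (range (hessian (aniso L G \<delta>)))
          \<and> strongly_monotone (gradient (aniso L G \<delta>))"
      using C2_aniso bounded_hessian mono unfolding strongly_monotone_def by (meson less_imp_le)
    show "C1_function (aniso L G 0)"
      by (simp add: C1_aniso)
    show "\<exists>C>0. \<forall>\<delta>>0. \<forall>p. norm (gradient (aniso L G \<delta>) p) \<le> C * norm p"
      "\<exists>C>0. \<forall>p. norm (gradient (aniso L G 0) p) \<le> C * norm p"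
      using norm_grad_le hess_const_pos by (auto simp: gradient_aniso)
  qed
qed

end
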